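(* Let $0<a'<a<b<b'<\infty$, $L>1$, $N\ge 1$. Let $\mu$ be a pseudo-positive measure with support in the annulus $A_{a,b}\subset\mathbb{R}^d$, and let $C_N(f)$ be the polyharmonic Gauss–Jacobi cubature formula. For each $k\ge 0$ let $C_k$ be a constant such that the errors of the component quadrature formulas satisfy $$\left|\int_a^b g\,d\mu_{k,\ell}-\int_a^b g\,d\mu^G_{k,\ell}\right|\le C_k\|g\|_{H^2(\mathbb{A}_{a',b'})}\qquad\text{for all }g\in H^{2,k}(\mathbb{A}_{a',b'}),\ \ell=1,\dots,a_k .$$ Let $f\in H_L^2(\mathcal{A}_{a',b'})$ have a finite expansion $f(z,\theta)=\sum_{k\le k_0}\sum_{\ell=1}^{a_k}f_{k,\ell}(z)Y_{k,\ell}(\theta)$ for some $k_0\ge 0$, and put $f(x)=f(r,\theta)$ for $x=r\theta$, $r=|x|$. Then $$\left|\int_{A_{a,b}}f(x)\,d\mu(x)-C_N(f)\right|\le\sqrt{\sum_{k\le k_0}\sum_{\ell=1}^{a_k}\frac{C_k^2}{L^{2k}}}\ \cdot\ \|f\|_{H_L^2(\mathcal{A}_{a',b'})}.$$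
   Context: $\mathbb{A}_{a,b}=\{z\in\mathbb{C}:a<|z|<b\}$, $\mathcal{A}_{a,b}=\mathbb{A}_{a,b}\times\mathbb{S}^{d-1}$, where $\mathbb{S}^{d-1}$ is the unit sphere of $\mathbb{R}^d$ with rotation invariant measure $d\theta$; $A_{a,b}=\{x\in\mathbb{R}^d:a<|x|<b\}$. $\mathcal{H}_k(\mathbb{R}^d)$ is the space of homogeneous harmonic polynomials of degree $k$, $a_k=\dim\mathcal{H}_k(\mathbb{R}^d)$, and $Y_{k,\ell}$, $\ell=1,\dots,a_k$, are real-valued and form an orthonormal basis of $\mathcal{H}_k(\mathbb{R}^d)$ in $L_2(\mathbb{S}^{d-1},d\theta)$. $H^2(\mathbb{A}_{a',b'})$ is the classical Hardy space of analytic functions on $\mathbb{A}_{a',b'}$ with $\sup_{a'<r<b'}\frac1{2\pi}\int_0^{2\pi}|f(re^{i\varphi})|^2d\varphi<\infty$, with norm $\|f\|^2=\frac1{2\pi}\int_0^{2\pi}|f^*(a'e^{i\varphi})|^2d\varphi+\frac1{2\pi}\int_0^{2\pi}|f^*(b'e^{i\varphi})|^2d\varphi$ where $f^*$ denotes $L_2$ boundary values. $H^{2,k}(\mathbb{A}_{a',b'})$ is the closure in it of $\operatorname{span}\{z^{k+2j},z^{-d-k+2+2j}:j\ge 0\}$. $H_L^2(\mathcal{A}_{a',b'})$ consists of all $f(z,\theta)=\sum_{k,\ell}f_{k,\ell}(z)Y_{k,\ell}(\theta)$ with $f_{k,\ell}\in H^{2,k}(\mathbb{A}_{a',b'})$ and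 $\|f\|^2_{H_L^2}=\sum_{k,\ell}\|f_{k,\ell}\|^2_{H^2(\mathbb{A}_{a',b'})}L^{2k}<\infty$. A signed measure $\mu$ with support in $A_{a,b}$ is pseudo-positive if $\int h(|x|)Y_{k,\ell}(x)\,d\mu(x)\ge 0$ for every continuous $h:[a,b]\to[0,\infty)$ and all $k\ge 0$, $1\le\ell\le a_k$. Its component measures $\mu_{k,\ell}\ge 0$ on $[a,b]$ are defined by $\int_a^b g(r)\,d\mu_{k,\ell}(r)=\int_{A_{a,b}} g(|x|)Y_{k,\ell}(x/|x|)\,d\mu(x)$. For each $(k,\ell)$ let $V_{k,d,2N}=\operatorname{span}\{r^{k+2j},r^{-d-k+2+2j}:0\le j\le 2N-1\}$, and let $t_{k,\ell;j}\in[a,b]$ and $\lambda_{k,\ell;j}\ge 0$, $j=1,\dots,2N$, be the knots and weights of the Gauss–Jacobi type quadrature formula $\int_a^bQ\,d\mu_{k,\ell}=\sum_{j=1}^{2N}\lambda_{k,\ell;j}Q(t_{k,\ell;j})$ valid for all $Q\in V_{k,d,2N}$. Put $\mu^G_{k,\ell}=\sum_{j=1}^{2N}\lambda_{k,\ell;j}\delta_{t_{k,\ell;j}}$. For $f$ with finite expansion $f(r\theta)=\sum_{k\le k_0,\ell}f_{k,\ell}(r)Y_{k,\ell}(\theta)$ the cubature formula is $C_N(f)=\sum_{k\le k_0}\sum_{\ell=1}^{a_k}\int_a^bf_{k,\ell}(r)\,d\mu^G_{k,\ell}(r)$. *)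

theory Defs
  imports "HOL-Analysis.Analysis" "HOL-Library.Function_Algebras"
begin

section \<open>Linear spans and dimension in function spaces\<close>

definition fun_scale :: "'k::field \<Rightarrow> ('a \<Rightarrow> 'k) \<Rightarrow> ('a \<Rightarrow> 'k)"
  where "fun_scale c f = (\<lambda>x. c * f x)"

definition fun_span :: "('a \<Rightarrow> 'k::field) set \<Rightarrow> ('a \<Rightarrow> 'k) set"
  where "fun_span S = module.span fun_scale S"

definition fun_dim :: "('a \<Rightarrow> 'k::field) set \<Rightarrow> nat"
  where "fun_dim V = vector_space.dim fun_scale V"


section \<open>Annuli\<close>

text \<open>Used both for the annulus in the complex plane and for the one in Euclidean space.\<close>

definition annulus :: "real \<Rightarrow> real \<Rightarrow> 'a::real_normed_vector set"
  where "annulus a b = {x. a < norm x \<and> norm x < b}"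


section \<open>Signed measures\<close>

text \<open>A signed measure is a real-valued countably additive set function on the Borel sets; its
  integral is taken through the Jordan decomposition. The positive part is the upper variation
  \<open>A \<mapsto> sup {\<mu> B | B \<subseteq> A Borel}\<close> (\<open>ennreal\<close> truncates negative values, which does not change the
  supremum because the empty set is admissible); the negative part is the upper variation
  of \<open>- \<mu>\<close>.\<close>

definition signed_borel_measure :: "('a::topological_space set \<Rightarrow> real) \<Rightarrow> bool"
  where "signed_borel_measure \<mu> \<longleftrightarrow> \<mu> {} = 0 \<and>
    (\<forall>A :: nat \<Rightarrow> 'a set. range A \<subseteq> sets borel \<longrightarrow> disjoint_family A \<longrightarrow>
       (\<lambda>i. \<mu> (A i)) sums \<mu> (\<Union>i. A i))"

definition upper_variation :: "('a::topological_space set \<Rightarrow> real) \<Rightarrow> 'a measure"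
  where "upper_variation \<mu> = measure_of UNIV (sets borel)
    (\<lambda>A. SUP B\<in>{B \<in> sets borel. B \<subseteq> A}. ennreal (\<mu> B))"

definition signed_integral ::
    "('a::topological_space set \<Rightarrow> real) \<Rightarrow> ('a \<Rightarrow> 'b::{banach, second_countable_topology}) \<Rightarrow> 'b"
  where "signed_integral \<mu> f =
    integral\<^sup>L (upper_variation \<mu>) f - integral\<^sup>L (upper_variation (\<lambda>A. - \<mu> A)) f"

definition signed_set_integral ::
    "('a::topological_space set \<Rightarrow> real) \<Rightarrow> 'a set \<Rightarrow>
      ('a \<Rightarrow> 'b::{banach, second_countable_topology}) \<Rightarrow> 'b"
  where "signed_set_integral \<mu> A f = signed_integral \<mu> (\<lambda>x. indicator A x *\<^sub>R f x)"

definition signed_support :: "('a::topological_space set \<Rightarrow> real) \<Rightarrow> 'a set"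
  where "signed_support \<mu> =
    {x. \<forall>U. open U \<and> x \<in> U \<longrightarrow> (\<exists>B\<in>sets borel. B \<subseteq> U \<and> \<mu> B \<noteq> 0)}"


section \<open>Spherical harmonics\<close>

text \<open>The measure \<open>d\<theta>\<close> is a Borel measure on the whole space carried by the unit sphere. It is
  determined up to a positive factor, and no normalization is chosen.\<close>

definition rotation_invariant_sphere_measure :: "(real ^ 'd) measure \<Rightarrow> bool"
  where "rotation_invariant_sphere_measure \<sigma> \<longleftrightarrow>
    sets \<sigma> = sets borel \<and> finite_measure \<sigma> \<and>
    emeasure \<sigma> (- sphere 0 1) = 0 \<and> emeasure \<sigma> (sphere 0 1) \<noteq> 0 \<and>
    (\<forall>T. orthogonal_transformation T \<longrightarrow> distr \<sigma> borel T = \<sigma>)"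

definition laplacian :: "(real ^ 'd \<Rightarrow> real) \<Rightarrow> real ^ 'd \<Rightarrow> real"
  where "laplacian p x = (\<Sum>b\<in>Basis. (deriv ^^ 2) (\<lambda>t. p (x + t *\<^sub>R b)) 0)"

definition harmonic_space :: "nat \<Rightarrow> (real ^ 'd \<Rightarrow> real) set"
  where "harmonic_space k = {p. real_polynomial_function p \<and>
    (\<forall>t x. p (t *\<^sub>R x) = t ^ k * p x) \<and> (\<forall>x. laplacian p x = 0)}"

definition harmonic_dim :: "'d::finite itself \<Rightarrow> nat \<Rightarrow> nat"
  where "harmonic_dim _ k = fun_dim (harmonic_space k :: (real ^ 'd \<Rightarrow> real) set)"

definition harmonic_bases ::
    "(real ^ 'd) measure \<Rightarrow> (nat \<Rightarrow> nat \<Rightarrow> real ^ 'd \<Rightarrow> real) \<Rightarrow> bool"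
  where "harmonic_bases \<sigma> Y \<longleftrightarrow> (\<forall>k.
    fun_span (Y k ` {1..harmonic_dim TYPE('d) k}) = harmonic_space k \<and>
    (\<forall>l\<in>{1..harmonic_dim TYPE('d) k}. \<forall>l'\<in>{1..harmonic_dim TYPE('d) k}.
       (LINT \<theta>:sphere 0 1|\<sigma>. Y k l \<theta> * Y k l' \<theta>) = (if l = l' then 1 else 0)))"


section \<open>Hardy spaces\<close>

definition circle_mean_sq :: "(real \<Rightarrow> complex) \<Rightarrow> real"
  where "circle_mean_sq g = 1 / (2 * pi) * (LINT \<phi>:{0..2*pi}|lborel. (cmod (g \<phi>))\<^sup>2)"

definition hardy_space :: "real \<Rightarrow> real \<Rightarrow> (complex \<Rightarrow> complex) set"
  where "hardy_space a' b' = {f. f analytic_on annulus a' b' \<and>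
    bdd_above ((\<lambda>r. circle_mean_sq (\<lambda>\<phi>. f (of_real r * cis \<phi>))) ` {a'<..<b'})}"

text \<open>\<open>F\<close> is the filter of radii approaching the boundary circle from inside the annulus. Boundary
  values are unique up to a null set, so the norm below does not depend on the choice.\<close>

definition is_L2_boundary_value :: "(complex \<Rightarrow> complex) \<Rightarrow> real filter \<Rightarrow> (real \<Rightarrow> complex) \<Rightarrow> bool"
  where "is_L2_boundary_value f F g \<longleftrightarrow>
    set_borel_measurable lborel {0..2*pi} g \<and>
    set_integrable lborel {0..2*pi} (\<lambda>\<phi>. (cmod (g \<phi>))\<^sup>2) \<and>
    ((\<lambda>r. LINT \<phi>:{0..2*pi}|lborel. (cmod (f (of_real r * cis \<phi>) - g \<phi>))\<^sup>2) \<longlongrightarrow> 0) F"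

definition L2_boundary_value :: "(complex \<Rightarrow> complex) \<Rightarrow> real filter \<Rightarrow> real \<Rightarrow> complex"
  where "L2_boundary_value f F = (SOME g. is_L2_boundary_value f F g)"

definition hardy_norm :: "real \<Rightarrow> real \<Rightarrow> (complex \<Rightarrow> complex) \<Rightarrow> real"
  where "hardy_norm a' b' f = sqrt
    (circle_mean_sq (L2_boundary_value f (at_right a')) +
     circle_mean_sq (L2_boundary_value f (at_left b')))"

definition hardy_generators :: "nat \<Rightarrow> nat \<Rightarrow> (complex \<Rightarrow> complex) set"
  where "hardy_generators d k =
    (\<Union>j::nat. {\<lambda>z. z powi (int k + 2 * int j), \<lambda>z. z powi (- int d - int k + 2 + 2 * int j)})"

definition hardy_space_k :: "nat \<Rightarrow> real \<Rightarrow> real \<Rightarrow> nat \<Rightarrow> (complex \<Rightarrow> complex) set"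
  where "hardy_space_k d a' b' k = {f \<in> hardy_space a' b'.
    \<forall>\<epsilon>>0. \<exists>p\<in>fun_span (hardy_generators d k). hardy_norm a' b' (\<lambda>z. f z - p z) < \<epsilon>}"

text \<open>The coefficient functions \<open>f\<^bsub>k,l\<^esub>\<close> of \<open>f\<close> are its Fourier coefficients with respect to the
  orthonormal spherical harmonics.\<close>

definition laplace_coeff ::
    "(real ^ 'd) measure \<Rightarrow> (nat \<Rightarrow> nat \<Rightarrow> real ^ 'd \<Rightarrow> real) \<Rightarrow>
      (complex \<Rightarrow> real ^ 'd \<Rightarrow> complex) \<Rightarrow> nat \<Rightarrow> nat \<Rightarrow> complex \<Rightarrow> complex"
  where "laplace_coeff \<sigma> Y f k l z = (LINT \<theta>:sphere 0 1|\<sigma>. f z \<theta> * of_real (Y k l \<theta>))"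

definition harmonic_index :: "'d::finite itself \<Rightarrow> (nat \<times> nat) set"
  where "harmonic_index D = (SIGMA k:UNIV. {1..harmonic_dim D k})"

definition HL2_space ::
    "(real ^ 'd) measure \<Rightarrow> (nat \<Rightarrow> nat \<Rightarrow> real ^ 'd \<Rightarrow> real) \<Rightarrow> real \<Rightarrow> real \<Rightarrow> real \<Rightarrow>
      (complex \<Rightarrow> real ^ 'd \<Rightarrow> complex) set"
  where "HL2_space \<sigma> Y a' b' L = {f.
    (\<forall>(k, l)\<in>harmonic_index TYPE('d).
       laplace_coeff \<sigma> Y f k l \<in> hardy_space_k CARD('d) a' b' k) \<and>
    (\<forall>z\<in>annulus a' b'. \<forall>\<theta>\<in>sphere 0 1.
       ((\<lambda>(k, l). laplace_coeff \<sigma> Y f k l z * of_real (Y k l \<theta>)) has_sum f z \<theta>)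
         (harmonic_index TYPE('d))) \<and>
    (\<lambda>(k, l). (hardy_norm a' b' (laplace_coeff \<sigma> Y f k l))\<^sup>2 * L ^ (2 * k))
       summable_on harmonic_index TYPE('d)}"

definition HL2_norm ::
    "(real ^ 'd) measure \<Rightarrow> (nat \<Rightarrow> nat \<Rightarrow> real ^ 'd \<Rightarrow> real) \<Rightarrow> real \<Rightarrow> real \<Rightarrow> real \<Rightarrow>
      (complex \<Rightarrow> real ^ 'd \<Rightarrow> complex) \<Rightarrow> real"
  where "HL2_norm \<sigma> Y a' b' L f = sqrt (\<Sum>\<^sub>\<infinity>(k, l)\<in>harmonic_index TYPE('d).
    (hardy_norm a' b' (laplace_coeff \<sigma> Y f k l))\<^sup>2 * L ^ (2 * k))"


section \<open>Pseudo-positive measures and their component measures\<close>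

text \<open>In \<open>pseudo_positive\<close> the harmonic \<open>Y k l\<close> is evaluated at \<open>x\<close>, in \<open>is_component_measure\<close> at
  \<open>x / |x|\<close>.\<close>

definition pseudo_positive ::
    "(nat \<Rightarrow> nat \<Rightarrow> real ^ 'd \<Rightarrow> real) \<Rightarrow> real \<Rightarrow> real \<Rightarrow> ((real ^ 'd) set \<Rightarrow> real) \<Rightarrow> bool"
  where "pseudo_positive Y a b \<mu> \<longleftrightarrow>
    (\<forall>h k l. continuous_on {a..b} h \<longrightarrow> (\<forall>r\<in>{a..b}. h r \<ge> 0) \<longrightarrow>
       l \<in> {1..harmonic_dim TYPE('d) k} \<longrightarrow>
       signed_set_integral \<mu> (annulus a b) (\<lambda>x. h (norm x) * Y k l x) \<ge> (0::real))"

definition is_component_measure ::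
    "real \<Rightarrow> real \<Rightarrow> ((real ^ 'd) set \<Rightarrow> real) \<Rightarrow> (real ^ 'd \<Rightarrow> real) \<Rightarrow> real measure \<Rightarrow> bool"
  where "is_component_measure a b \<mu> y m \<longleftrightarrow>
    sets m = sets borel \<and> finite_measure m \<and> emeasure m (- {a..b}) = 0 \<and>
    (\<forall>g :: real \<Rightarrow> real. continuous_on {a..b} g \<longrightarrow>
       (LINT r:{a..b}|m. g r) =
       signed_set_integral \<mu> (annulus a b) (\<lambda>x. g (norm x) * y (x /\<^sub>R norm x)))"


section \<open>Gauss--Jacobi quadrature and polyharmonic cubature\<close>

text \<open>\<open>quadrature_space d k n\<close> has the generators with \<open>j < n\<close>, i.e. \<open>0 \<le> j \<le> 2 N - 1\<close>
  for \<open>n = 2 N\<close>.\<close>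

definition quadrature_space :: "nat \<Rightarrow> nat \<Rightarrow> nat \<Rightarrow> (real \<Rightarrow> real) set"
  where "quadrature_space d k n = fun_span
    (\<Union>j\<in>{..<n}. {\<lambda>r. r powi (int k + 2 * int j), \<lambda>r. r powi (- int d - int k + 2 + 2 * int j)})"

definition gauss_jacobi_rule ::
    "nat \<Rightarrow> real \<Rightarrow> real \<Rightarrow> nat \<Rightarrow> nat \<Rightarrow> real measure \<Rightarrow> (nat \<Rightarrow> real) \<Rightarrow> (nat \<Rightarrow> real) \<Rightarrow> bool"
  where "gauss_jacobi_rule d a b N k m t w \<longleftrightarrow>
    (\<forall>j\<in>{1..2*N}. t j \<in> {a..b} \<and> w j \<ge> 0) \<and>
    (\<forall>Q\<in>quadrature_space d k (2 * N).
       (LINT r:{a..b}|m. Q r) = (\<Sum>j=1..2*N. w j * Q (t j)))"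

text \<open>The image under \<open>t\<close> of the measure with mass \<open>w j\<close> at \<open>j\<close> is the weighted sum of the Dirac
  measures at the \<open>t j\<close>.\<close>

definition gauss_measure :: "nat \<Rightarrow> (nat \<Rightarrow> real) \<Rightarrow> (nat \<Rightarrow> real) \<Rightarrow> real measure"
  where "gauss_measure N t w = distr (point_measure {1..2*N} (\<lambda>j. ennreal (w j))) borel t"

definition cubature ::
    "(real ^ 'd) measure \<Rightarrow> (nat \<Rightarrow> nat \<Rightarrow> real ^ 'd \<Rightarrow> real) \<Rightarrow> real \<Rightarrow> real \<Rightarrow>
      (nat \<Rightarrow> nat \<Rightarrow> real measure) \<Rightarrow> nat \<Rightarrow> (complex \<Rightarrow> real ^ 'd \<Rightarrow> complex) \<Rightarrow> complex"
  where "cubature \<sigma> Y a b \<mu>G k0 f = (\<Sum>k\<le>k0. \<Sum>l=1..harmonic_dim TYPE('d) k.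
    (LINT r:{a..b}|\<mu>G k l. laplace_coeff \<sigma> Y f k l (of_real r)))"

end

theory Submission
  imports Defs
begin

text \<open>
  On the annulus the integrand is the finite sum of the products
  \<open>f\<^bsub>k,l\<^esub>(|x|) Y\<^bsub>k,l\<^esub>(x/|x|)\<close>, so integrating it against \<open>\<mu>\<close> amounts to integrating each
  coefficient \<open>f\<^bsub>k,l\<^esub>\<close> against the component measure \<open>\<mu>\<^bsub>k,l\<^esub>\<close>. The cubature formula replaces
  \<open>\<mu>\<^bsub>k,l\<^esub>\<close> by its quadrature, hence the total error is the sum of the one-dimensional errors,
  each of which is at most \<open>C\<^bsub>k\<^esub> \<parallel>f\<^bsub>k,l\<^esub>\<parallel>\<close>. Writing
  \<open>C\<^bsub>k\<^esub> \<parallel>f\<^bsub>k,l\<^esub>\<parallel> = (C\<^bsub>k\<^esub> / L\<^sup>k) (\<parallel>f\<^bsub>k,l\<^esub>\<parallel> L\<^sup>k)\<close>, the Cauchy--Schwarz inequality gives the claim.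

  The measure-theoretic work lies in the linearity of the integral against a signed measure. It is
  a difference of two Bochner integrals, which are additive only on integrable functions, so the
  upper variations of \<open>\<mu>\<close> and \<open>- \<mu>\<close> must be finite. This rests on the classical fact that a
  real-valued countably additive set function is bounded (\<open>signed_borel_measure_bounded\<close>).
  The component identity, known for real test functions, extends to complex ones through real
  and imaginary parts (\<open>component_measure_integral_complex\<close>).
\<close>

section \<open>Finiteness of the variations of a signed measure\<close>

lemma signed_borel_measure_minus:
  assumes "signed_borel_measure \<mu>"
  shows "signed_borel_measure (\<lambda>A. - \<mu> A)"
  using assms unfolding signed_borel_measure_def by (auto intro!: sums_minus)

lemma signed_borel_measure_Un:
  assumes \<mu>: "signed_borel_measure \<mu>"
    and AB: "A \<in> sets borel" "B \<in> sets borel" "A \<inter> B = {}"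
  shows "\<mu> (A \<union> B) = \<mu> A + \<mu> B"
proof -
  have "range (binaryset A B) \<subseteq> sets borel"
    using AB by (auto simp: binaryset_def)
  moreover have "disjoint_family (binaryset A B)"
    using AB by (auto simp: disjoint_family_on_def binaryset_def)
  ultimately have "(\<lambda>i. \<mu> (binaryset A B i)) sums \<mu> (\<Union>i. binaryset A B i)"
    using \<mu> unfolding signed_borel_measure_def by blast
  moreover have "(\<lambda>i. \<mu> (binaryset A B i)) sums (\<mu> A + \<mu> B)"
    using \<mu> by (intro binaryset_sums) (simp add: signed_borel_measure_def)
  ultimately show ?thesis
    by (simp add: UN_binaryset_eq sums_unique2)
qed

text \<open>
  If the values on the Borel subsets of \<open>A\<close> are unbounded, choose \<open>B \<subseteq> A\<close> with
  \<open>|\<mu> B| > |\<mu> A| + 1\<close>. Then both \<open>B\<close> and \<open>A - B\<close> have mass larger than \<open>1\<close> in absolute value, and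
  the values are still unbounded on one of the two. Iterating splits off infinitely many
  disjoint sets of mass larger than \<open>1\<close>, against the convergence of their series.
\<close>

lemma signed_borel_measure_bounded:
  fixes \<mu> :: "'a::topological_space set \<Rightarrow> real"
  assumes \<mu>: "signed_borel_measure \<mu>"
  shows "\<exists>K. \<forall>B\<in>sets borel. \<bar>\<mu> B\<bar> \<le> K"
proof (rule ccontr)
  assume unb: "\<not> ?thesis"
  define U where
    "U A \<longleftrightarrow> A \<in> sets borel \<and> (\<forall>K. \<exists>B\<in>sets borel. B \<subseteq> A \<and> \<bar>\<mu> B\<bar> > K)" for A
  have U0: "U UNIV"
    using unb by (auto simp: U_def not_le)
  have step: "\<exists>A'. U A' \<and> A' \<subseteq> A \<and> \<bar>\<mu> (A - A')\<bar> > 1" if A: "U A" for A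
  proof -
    obtain B where B: "B \<in> sets borel" "B \<subseteq> A" "\<bar>\<mu> B\<bar> > \<bar>\<mu> A\<bar> + 1"
      using A unfolding U_def by blast
    have Ab: "A \<in> sets borel" and Db: "A - B \<in> sets borel"
      using A B by (auto simp: U_def)
    have "\<mu> (B \<union> (A - B)) = \<mu> B + \<mu> (A - B)"
      using B Db by (intro signed_borel_measure_Un[OF \<mu>]) auto
    moreover have "B \<union> (A - B) = A"
      using B by blast
    ultimately have "\<mu> A = \<mu> B + \<mu> (A - B)"
      by simp
    then have D: "\<bar>\<mu> (A - B)\<bar> > 1"
      using B(3) by linarith
    have "U B \<or> U (A - B)"
    proof (rule ccontr)
      assume "\<not> (U B \<or> U (A - B))"
      then obtain K1 K2 where
        K1: "\<And>E. E \<in> sets borel \<Longrightarrow> E \<subseteq> B \<Longrightarrow> \<bar>\<mu> E\<bar> \<le> K1" and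
        K2: "\<And>E. E \<in> sets borel \<Longrightarrow> E \<subseteq> A - B \<Longrightarrow> \<bar>\<mu> E\<bar> \<le> K2"
        using B Db unfolding U_def not_less[symmetric] by metis
      obtain E where E: "E \<in> sets borel" "E \<subseteq> A" "\<bar>\<mu> E\<bar> > K1 + K2"
        using A unfolding U_def by blast
      have "\<mu> ((E \<inter> B) \<union> (E - B)) = \<mu> (E \<inter> B) + \<mu> (E - B)"
        using B E by (intro signed_borel_measure_Un[OF \<mu>]) auto
      moreover have "(E \<inter> B) \<union> (E - B) = E"
        by blast
      moreover have "\<bar>\<mu> (E \<inter> B)\<bar> \<le> K1" "\<bar>\<mu> (E - B)\<bar> \<le> K2"
        using B E by (auto intro!: K1 K2)
      ultimately show False
        using E(3) abs_triangle_ineq[of "\<mu> (E \<inter> B)" "\<mu> (E - B)"] by simp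
    qed
    then show ?thesis
    proof
      assume "U B"
      with B D show ?thesis by blast
    next
      assume "U (A - B)"
      moreover have "A - (A - B) = B"
        using B by blast
      ultimately show ?thesis
        using B by (intro exI[of _ "A - B"]) auto
    qed
  qed
  obtain F where F: "\<And>n::nat. U (F n)"
      and F_step: "\<And>n. F (Suc n) \<subseteq> F n \<and> \<bar>\<mu> (F n - F (Suc n))\<bar> > 1"
    using dependent_nat_choice[of "\<lambda>_. U" "\<lambda>_ A A'. A' \<subseteq> A \<and> \<bar>\<mu> (A - A')\<bar> > 1"] U0 step
    by metis
  define D where "D n = F n - F (Suc n)" for n
  have F_anti: "F n \<subseteq> F m" if "m \<le> n" for m n
    by (rule lift_Suc_antimono_le[of F, OF _ that]) (use F_step in blast)
  have disj: "D m \<inter> D n = {}" if "m < n" for m n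
    using F_anti[of "Suc m" n] that unfolding D_def by (blast dest: Suc_leI)
  have "disjoint_family D"
    unfolding disjoint_family_on_def
    using disj by (metis inf_commute linorder_neqE_nat)
  moreover have "range D \<subseteq> sets borel"
    using F by (auto simp: D_def U_def)
  ultimately have "(\<lambda>i. \<mu> (D i)) sums \<mu> (\<Union>i. D i)"
    using \<mu> unfolding signed_borel_measure_def by blast
  then have "(\<lambda>i. \<mu> (D i)) \<longlonglongrightarrow> 0"
    by (simp add: sums_iff summable_LIMSEQ_zero)
  then obtain n where "\<bar>\<mu> (D n)\<bar> < 1"
    using LIMSEQ_D[of "\<lambda>i. \<mu> (D i)" 0 1] by auto
  then show False
    using F_step[of n] by (simp add: D_def)
qed

lemma sets_upper_variation [simp]: "sets (upper_variation \<mu>) = sets borel"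
proof -
  have "sigma_algebra UNIV (sets (borel :: 'a measure))"
    using sets.sigma_algebra_axioms[of borel] by simp
  then show ?thesis
    by (simp add: upper_variation_def sigma_algebra.sigma_sets_eq)
qed

text \<open>
  By the definition of \<open>measure_of\<close>, the measure of the whole space is either the supremum of the
  values of \<open>\<mu>\<close> or zero, and a bound for \<open>\<mu>\<close> controls both.
\<close>

lemma finite_measure_upper_variation:
  assumes "signed_borel_measure \<mu>"
  shows "finite_measure (upper_variation \<mu>)"
proof (rule finite_measureI)
  obtain K where K: "\<And>B. B \<in> sets borel \<Longrightarrow> \<bar>\<mu> B\<bar> \<le> K"
    using signed_borel_measure_bounded[OF assms] by blast
  have "(SUP B\<in>{B \<in> sets borel. B \<subseteq> UNIV}. ennreal (\<mu> B)) \<le> ennreal K"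
    by (intro SUP_least ennreal_leI) (use K in force)
  then have "emeasure (upper_variation \<mu>) UNIV \<le> ennreal K"
    unfolding upper_variation_def by (simp add: emeasure_measure_of_conv)
  moreover have "space (upper_variation \<mu>) = UNIV"
    using sets_eq_imp_space_eq[OF sets_upper_variation[of \<mu>]] by simp
  ultimately show "emeasure (upper_variation \<mu>) (space (upper_variation \<mu>)) \<noteq> \<infinity>"
    using ennreal_less_top[of K] by (auto simp: top_unique)
qed


section \<open>Linearity of the signed integral\<close>

lemma open_annulus: "open (annulus a b :: 'a::real_normed_vector set)"
proof -
  have "annulus a b = norm -` {a<..<b} \<inter> (UNIV :: 'a set)"
    by (auto simp: annulus_def)
  then show ?thesis
    using continuous_on_open_vimage[of "UNIV :: 'a set" norm]
    by (metis continuous_on_norm_id inf_top.right_neutral open_UNIV open_greaterThanLessThan)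
qed

lemma set_integrable_continuous_bounded:
  fixes h :: "'a::topological_space \<Rightarrow> 'b::{banach, second_countable_topology}"
  assumes M: "finite_measure M" "sets M = sets borel"
    and A: "A \<in> sets borel" "continuous_on A h" "bounded (h ` A)"
  shows "set_integrable M A h"
proof -
  obtain K where K: "\<And>x. x \<in> A \<Longrightarrow> norm (h x) \<le> K"
    using A(3) by (auto simp: bounded_iff)
  have "(\<lambda>x. indicator A x *\<^sub>R h x) \<in> borel_measurable borel"
    using A by (intro borel_measurable_continuous_on_indicator)
  then have "(\<lambda>x. indicator A x *\<^sub>R h x) \<in> borel_measurable M"
    using measurable_cong_sets[OF M(2) refl] by blast
  moreover have "norm (indicator A x *\<^sub>R h x) \<le> \<bar>K\<bar>" for x
    using K[of x] by (auto simp: indicator_def)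
  ultimately show ?thesis
    unfolding set_integrable_def
    by (intro finite_measure.integrable_const_bound[OF M(1), where B = "\<bar>K\<bar>"]) auto
qed

text \<open>
  Both Bochner integrals in \<open>signed_set_integral\<close> are required to exist, which excludes the default
  value \<open>0\<close> in either of them.
\<close>

definition signed_set_integrable ::
    "('a::topological_space set \<Rightarrow> real) \<Rightarrow> 'a set \<Rightarrow>
      ('a \<Rightarrow> 'b::{banach, second_countable_topology}) \<Rightarrow> bool"
  where "signed_set_integrable \<mu> A f \<longleftrightarrow>
    set_integrable (upper_variation \<mu>) A f \<and> set_integrable (upper_variation (\<lambda>A. - \<mu> A)) A f"

lemma signed_set_integrable_continuous_bounded:
  assumes "signed_borel_measure \<mu>"
    and "A \<in> sets borel" "continuous_on A h" "bounded (h ` A)"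
  shows "signed_set_integrable \<mu> A h"
  unfolding signed_set_integrable_def using assms
  by (intro conjI set_integrable_continuous_bounded finite_measure_upper_variation
      signed_borel_measure_minus) auto

lemma signed_set_integral_cong:
  assumes "\<And>x. x \<in> A \<Longrightarrow> f x = g x"
  shows "signed_set_integral \<mu> A f = signed_set_integral \<mu> A g"
proof -
  have "(\<lambda>x. indicator A x *\<^sub>R f x) = (\<lambda>x. indicator A x *\<^sub>R g x)"
    by (intro ext) (use assms in \<open>auto simp: indicator_def\<close>)
  then show ?thesis
    by (simp add: signed_set_integral_def)
qed

lemma signed_set_integral_sum:
  assumes "\<And>i. i \<in> I \<Longrightarrow> signed_set_integrable \<mu> A (f i)"
  shows "signed_set_integral \<mu> A (\<lambda>x. \<Sum>i\<in>I. f i x) = (\<Sum>i\<in>I. signed_set_integral \<mu> A (f i))"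
  using assms
  by (simp add: signed_set_integrable_def set_integrable_def signed_set_integral_def
      signed_integral_def scaleR_sum_right Bochner_Integration.integral_sum sum_subtractf)

lemma signed_set_integral_bounded_linear:
  assumes T: "bounded_linear T" and "signed_set_integrable \<mu> A f"
  shows "signed_set_integral \<mu> A (\<lambda>x. T (f x)) = T (signed_set_integral \<mu> A f)"
proof -
  have T_scale: "indicator A x *\<^sub>R T (f x) = T (indicator A x *\<^sub>R f x)" for x
    by (simp add: linear_scale[OF bounded_linear.linear[OF T]])
  show ?thesis
    using assms(2)
    by (simp add: signed_set_integrable_def set_integrable_def signed_set_integral_def
        signed_integral_def T_scale integral_bounded_linear[OF T]
        linear_diff[OF bounded_linear.linear[OF T]])
qed


section \<open>Component measures\<close>

lemma is_component_measureD:
  assumes "is_component_measure a b \<mu> y m"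
  shows "sets m = sets borel" "finite_measure m"
    and "\<And>g. continuous_on {a..b} g \<Longrightarrow> (LINT r:{a..b}|m. g r) =
       signed_set_integral \<mu> (annulus a b) (\<lambda>x. g (norm x) * y (x /\<^sub>R norm x))"
  using assms by (auto simp: is_component_measure_def)

text \<open>
  The product of a radial and an angular factor is continuous on the compact shell
  \<open>{x. a \<le> |x| \<and> |x| \<le> b}\<close>, and therefore bounded on the open annulus inside it.
\<close>

lemma signed_set_integrable_radial_angular:
  fixes g :: "real \<Rightarrow> complex" and y :: "real ^ 'd \<Rightarrow> real"
  assumes \<mu>: "signed_borel_measure \<mu>" and a: "0 < a"
    and g: "continuous_on {a..b} g" and y: "continuous_on UNIV y"
  shows "signed_set_integrable \<mu> (annulus a b)
    (\<lambda>x. g (norm x) * of_real (y (x /\<^sub>R norm x)))"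
proof -
  define S :: "(real ^ 'd) set" where "S = cball 0 b - ball 0 a"
  let ?h = "\<lambda>x. g (norm x) * of_real (y (x /\<^sub>R norm x))"
  have S: "x \<in> S \<longleftrightarrow> a \<le> norm x \<and> norm x \<le> b" for x
    by (auto simp: S_def)
  have "continuous_on S (\<lambda>x. g (norm x))"
    by (rule continuous_on_compose2[OF g]) (auto simp: S intro!: continuous_intros)
  moreover have "continuous_on S (\<lambda>x. y (x /\<^sub>R norm x))"
    using a by (intro continuous_on_compose2[OF y]) (auto simp: S intro!: continuous_intros)
  ultimately have cont: "continuous_on S ?h"
    by (intro continuous_intros)
  have sub: "annulus a b \<subseteq> S"
    by (auto simp: S annulus_def)
  have "compact S"
    unfolding S_def by (intro compact_diff) auto
  then have "bounded (?h ` S)"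
    by (intro compact_imp_bounded compact_continuous_image cont)
  then have "bounded (?h ` annulus a b)"
    using sub by (rule bounded_subset[OF _ image_mono])
  then show ?thesis
    by (intro signed_set_integrable_continuous_bounded[OF \<mu>] continuous_on_subset[OF cont sub])
      (auto intro: open_annulus borel_open)
qed

text \<open>
  A component measure is tested against real functions only. A real-linear functional on the
  complex numbers commutes with both integrals, and applying this to the real and the imaginary
  part reduces complex integrands to real ones.
\<close>

lemma component_measure_integral_complex:
  fixes g :: "real \<Rightarrow> complex" and y :: "real ^ 'd \<Rightarrow> real"
  assumes \<mu>: "signed_borel_measure \<mu>" and a: "0 < a"
    and m: "is_component_measure a b \<mu> y m"
    and g: "continuous_on {a..b} g" and y: "continuous_on UNIV y"
  shows "(LINT r:{a..b}|m. g r) =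
    signed_set_integral \<mu> (annulus a b) (\<lambda>x. g (norm x) * of_real (y (x /\<^sub>R norm x)))"
    (is "_ = signed_set_integral \<mu> _ ?h")
proof -
  have int_h: "signed_set_integrable \<mu> (annulus a b) ?h"
    by (rule signed_set_integrable_radial_angular[OF \<mu> a g y])
  have "bounded (g ` {a..b})"
    using g by (intro compact_imp_bounded compact_continuous_image) auto
  then have int_g: "set_integrable m {a..b} g"
    using is_component_measureD[OF m] g by (intro set_integrable_continuous_bounded) auto
  have part: "T (LINT r:{a..b}|m. g r) = T (signed_set_integral \<mu> (annulus a b) ?h)"
    if T: "bounded_linear T" and mult: "\<And>z s. T (z * of_real s) = T z * s"
    for T :: "complex \<Rightarrow> real"
  proof -
    have "indicator {a..b} r * T (g r) = T (indicator {a..b} r *\<^sub>R g r)" for r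
      by (simp add: linear_scale[OF bounded_linear.linear[OF T]])
    then have "T (LINT r:{a..b}|m. g r) = (LINT r:{a..b}|m. T (g r))"
      using int_g
      by (simp add: set_lebesgue_integral_def set_integrable_def integral_bounded_linear[OF T])
    also have "\<dots> = signed_set_integral \<mu> (annulus a b)
        (\<lambda>x. T (g (norm x)) * y (x /\<^sub>R norm x))"
      by (rule is_component_measureD(3)[OF m])
        (rule linear_continuous_on_compose[OF g bounded_linear.linear[OF T]])
    also have "\<dots> = signed_set_integral \<mu> (annulus a b) (\<lambda>x. T (?h x))"
      by (simp only: mult)
    also have "\<dots> = T (signed_set_integral \<mu> (annulus a b) ?h)"
      by (rule signed_set_integral_bounded_linear[OF T int_h])
    finally show ?thesis .
  qed
  show ?thesis
    by (rule complex_eqI) (rule part, simp_all add: bounded_linear_Re bounded_linear_Im)+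
qed


section \<open>Regularity of the harmonics and of the coefficients\<close>

lemma fun_span_superset:
  fixes S :: "('a \<Rightarrow> 'k::field) set"
  shows "S \<subseteq> fun_span S"
proof -
  have "module (fun_scale :: 'k::field \<Rightarrow> ('a \<Rightarrow> 'k) \<Rightarrow> 'a \<Rightarrow> 'k)"
    by standard (auto simp: fun_scale_def plus_fun_def algebra_simps)
  then show ?thesis
    by (simp add: fun_span_def module.span_superset)
qed

lemma harmonic_bases_continuous:
  fixes Y :: "nat \<Rightarrow> nat \<Rightarrow> real ^ 'd \<Rightarrow> real"
  assumes "harmonic_bases \<sigma> Y" "l \<in> {1..harmonic_dim TYPE('d) k}"
  shows "continuous_on UNIV (Y k l)"
proof -
  have "Y k l \<in> fun_span (Y k ` {1..harmonic_dim TYPE('d) k})"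
    using assms(2) by (intro subsetD[OF fun_span_superset] imageI)
  then have "Y k l \<in> harmonic_space k"
    using assms(1) by (simp add: harmonic_bases_def)
  then show ?thesis
    by (simp add: harmonic_space_def continuous_on_polymonial_function
        flip: real_polynomial_function_eq)
qed

text \<open>
  The interval from \<open>a\<close> to \<open>b\<close> on the real axis lies inside the open annulus on which \<open>g\<close> is analytic.
\<close>

lemma hardy_space_k_continuous_on_radius:
  assumes "g \<in> hardy_space_k d a' b' k" "0 < a'" "a' < a" "b < b'"
  shows "continuous_on {a..b} (\<lambda>r. g (of_real r))"
proof -
  have "continuous_on (annulus a' b') g"
    using assms(1) unfolding hardy_space_k_def hardy_space_def
    by (blast intro: holomorphic_on_imp_continuous_on analytic_imp_holomorphic)
  then show ?thesis
    by (rule continuous_on_compose2) (use assms in \<open>auto simp: annulus_def intro!: continuous_intros\<close>)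
qed


section \<open>The error estimate\<close>

theorem theorem7p2:
  fixes a' a b b' L :: real
    and N k0 :: nat
    and \<sigma> :: "(real ^ 'd) measure"
    and Y :: "nat \<Rightarrow> nat \<Rightarrow> real ^ 'd \<Rightarrow> real"
    and \<mu> :: "(real ^ 'd) set \<Rightarrow> real"
    and \<mu>comp :: "nat \<Rightarrow> nat \<Rightarrow> real measure"
    and t w :: "nat \<Rightarrow> nat \<Rightarrow> nat \<Rightarrow> real"
    and C :: "nat \<Rightarrow> real"
    and f :: "complex \<Rightarrow> real ^ 'd \<Rightarrow> complex"
  defines "\<mu>G \<equiv> (\<lambda>k l. gauss_measure N (t k l) (w k l))"
  assumes radii: "0 < a'" "a' < a" "a < b" "b < b'"
    and L: "L > 1"
    and N: "N \<ge> 1"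
    and sigma: "rotation_invariant_sphere_measure \<sigma>"
    and Y: "harmonic_bases \<sigma> Y"
    and mu: "signed_borel_measure \<mu>"
    and mu_support: "signed_support \<mu> \<subseteq> annulus a b"
    and mu_pos: "pseudo_positive Y a b \<mu>"
    and components: "\<And>k l. l \<in> {1..harmonic_dim TYPE('d) k} \<Longrightarrow>
          is_component_measure a b \<mu> (Y k l) (\<mu>comp k l)"
    and quadrature: "\<And>k l. l \<in> {1..harmonic_dim TYPE('d) k} \<Longrightarrow>
          gauss_jacobi_rule CARD('d) a b N k (\<mu>comp k l) (t k l) (w k l)"
    and errors: "\<And>k l g. l \<in> {1..harmonic_dim TYPE('d) k} \<Longrightarrow>
          g \<in> hardy_space_k CARD('d) a' b' k \<Longrightarrow>
          cmod ((LINT r:{a..b}|\<mu>comp k l. g (of_real r)) - (LINT r:{a..b}|\<mu>G k l. g (of_real r)))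
            \<le> C k * hardy_norm a' b' g"
    and f: "f \<in> HL2_space \<sigma> Y a' b' L"
    and f_finite: "\<And>z \<theta>. z \<in> annulus a' b' \<Longrightarrow> \<theta> \<in> sphere 0 1 \<Longrightarrow>
          f z \<theta> = (\<Sum>k\<le>k0. \<Sum>l=1..harmonic_dim TYPE('d) k.
            laplace_coeff \<sigma> Y f k l z * of_real (Y k l \<theta>))"
  shows "cmod (signed_set_integral \<mu> (annulus a b) (\<lambda>x. f (of_real (norm x)) (x /\<^sub>R norm x))
             - cubature \<sigma> Y a b \<mu>G k0 f)
         \<le> sqrt (\<Sum>k\<le>k0. \<Sum>l=1..harmonic_dim TYPE('d) k. (C k)\<^sup>2 / L ^ (2 * k))
             * HL2_norm \<sigma> Y a' b' L f"
proof -
  define I where "I = (SIGMA k:{..k0}. {1..harmonic_dim TYPE('d) k})"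
  define c where "c = (\<lambda>(k, l). laplace_coeff \<sigma> Y f k l)"
  define n where "n = (\<lambda>i. hardy_norm a' b' (c i))"
  have double_sum: "(\<Sum>k\<le>k0. \<Sum>l=1..harmonic_dim TYPE('d) k. F k l) = (\<Sum>(k, l)\<in>I. F k l)"
    for F :: "nat \<Rightarrow> nat \<Rightarrow> 'z::comm_monoid_add"
    unfolding I_def by (rule sum.Sigma) auto
  have fin: "finite I" and sub: "I \<subseteq> harmonic_index TYPE('d)"
    by (auto simp: I_def harmonic_index_def)
  have l: "snd i \<in> {1..harmonic_dim TYPE('d) (fst i)}" if "i \<in> I" for i
    using that by (auto simp: I_def)
  have c: "c i \<in> hardy_space_k CARD('d) a' b' (fst i)" if "i \<in> I" for i
    using f sub that by (auto simp: HL2_space_def c_def split: prod.splits)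
  have c_cont: "continuous_on {a..b} (\<lambda>r. c i (of_real r))" if "i \<in> I" for i
    by (rule hardy_space_k_continuous_on_radius[OF c[OF that]]) (use radii in auto)
  have Y_cont: "continuous_on UNIV (Y (fst i) (snd i))" if "i \<in> I" for i
    by (rule harmonic_bases_continuous[OF Y l[OF that]])
  have a: "0 < a"
    using radii by simp

  have "signed_set_integral \<mu> (annulus a b) (\<lambda>x. f (of_real (norm x)) (x /\<^sub>R norm x)) =
      signed_set_integral \<mu> (annulus a b)
        (\<lambda>x. \<Sum>i\<in>I. c i (of_real (norm x)) * of_real (Y (fst i) (snd i) (x /\<^sub>R norm x)))"
  proof (rule signed_set_integral_cong)
    fix x :: "real ^ 'd"
    assume "x \<in> annulus a b"
    then have x: "a < norm x" "norm x < b"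
      by (auto simp: annulus_def)
    then have "norm x \<noteq> 0"
      using a by linarith
    with x have "of_real (norm x) \<in> (annulus a' b' :: complex set)" "x /\<^sub>R norm x \<in> sphere 0 1"
      using radii by (auto simp: annulus_def)
    from f_finite[OF this]
    show "f (of_real (norm x)) (x /\<^sub>R norm x) =
        (\<Sum>i\<in>I. c i (of_real (norm x)) * of_real (Y (fst i) (snd i) (x /\<^sub>R norm x)))"
      unfolding double_sum by (simp add: c_def case_prod_beta)
  qed
  also have "\<dots> = (\<Sum>i\<in>I. signed_set_integral \<mu> (annulus a b)
      (\<lambda>x. c i (of_real (norm x)) * of_real (Y (fst i) (snd i) (x /\<^sub>R norm x))))"
    by (intro signed_set_integral_sum signed_set_integrable_radial_angular[OF mu a] c_cont Y_cont)
  also have "\<dots> = (\<Sum>i\<in>I. LINT r:{a..b}|\<mu>comp (fst i) (snd i). c i (of_real r))"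
    by (intro sum.cong refl component_measure_integral_complex[symmetric] mu a components l
        c_cont Y_cont)
  finally have integral_eq:
    "signed_set_integral \<mu> (annulus a b) (\<lambda>x. f (of_real (norm x)) (x /\<^sub>R norm x)) = \<dots>" .

  have "cmod (signed_set_integral \<mu> (annulus a b) (\<lambda>x. f (of_real (norm x)) (x /\<^sub>R norm x))
             - cubature \<sigma> Y a b \<mu>G k0 f) =
      cmod (\<Sum>i\<in>I. (LINT r:{a..b}|\<mu>comp (fst i) (snd i). c i (of_real r))
             - (LINT r:{a..b}|\<mu>G (fst i) (snd i). c i (of_real r)))"
    unfolding integral_eq cubature_def double_sum
    by (simp add: c_def case_prod_beta sum_subtractf)
  also have "\<dots> \<le> (\<Sum>i\<in>I. C (fst i) * n i)"
    unfolding n_def by (intro sum_norm_le errors l c)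
  \<comment> \<open>The weight is distributed so that Cauchy--Schwarz produces the weights of the norm.\<close>
  also have "\<dots> = (\<Sum>i\<in>I. C (fst i) / L ^ fst i * (n i * L ^ fst i))"
    using L by (intro sum.cong) auto
  also have "\<dots> \<le> sqrt ((\<Sum>i\<in>I. (C (fst i) / L ^ fst i)\<^sup>2) * (\<Sum>i\<in>I. (n i * L ^ fst i)\<^sup>2))"
    by (intro real_le_rsqrt Cauchy_Schwarz_ineq_sum)
  also have "\<dots> = sqrt (\<Sum>(k, l)\<in>I. (C k)\<^sup>2 / L ^ (2 * k)) *
      sqrt (\<Sum>i\<in>I. (n i)\<^sup>2 * L ^ (2 * fst i))"
    by (simp add: real_sqrt_mult case_prod_beta power_divide power_mult_distrib power_even_eq)
  also have "\<dots> \<le> sqrt (\<Sum>(k, l)\<in>I. (C k)\<^sup>2 / L ^ (2 * k)) * HL2_norm \<sigma> Y a' b' L f"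
  proof (intro mult_left_mono)
    let ?g = "\<lambda>(k, l). (hardy_norm a' b' (laplace_coeff \<sigma> Y f k l))\<^sup>2 * L ^ (2 * k)"
    have "sum ?g I \<le> infsum ?g (harmonic_index TYPE('d))"
      using f L by (intro finite_sum_le_infsum fin sub) (auto simp: HL2_space_def)
    then show "sqrt (\<Sum>i\<in>I. (n i)\<^sup>2 * L ^ (2 * fst i)) \<le> HL2_norm \<sigma> Y a' b' L f"
      by (simp add: HL2_norm_def n_def c_def case_prod_beta)
    show "0 \<le> sqrt (\<Sum>(k, l)\<in>I. (C k)\<^sup>2 / L ^ (2 * k))"
      using L by (intro real_sqrt_ge_zero sum_nonneg) auto
  qed
  finally show ?thesis
    unfolding double_sum .
qed

end
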